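(* Let $\Phi$ be the random dynamical system on $M=\mathbb{R}^N/\mathbb{Z}\cdot2\pi\mathbf{e}$ obtained from the unidirectionally coupled stochastic system with coupling coefficient $k$ (see context). Let $\mathcal{C}_M$ be the random cone field on $M$ given by $$\mathcal{C}_M^\omega(y)=\{\delta y\in T_yM\mid \delta y_{i+1}-\gamma_i\,\delta y_i\ge0,\ \ \beta_i\,\delta y_i-\delta y_{i+1}\ge0,\ \ i=1,\dots,N-1\},$$ with $\gamma_i^{-1}=1+2ik^{-1}$ and $\beta_i^{-1}=1-2ik^{-1}$. Then $\Phi$ is differentially positive with respect to $\mathcal{C}_M$, i.e. $$\mathrm{d}\Phi(t,y,\omega)\,\mathcal{C}_M^\omega(y)\subset\mathcal{C}_M^{\theta_t\omega}(\Phi(t,y,\omega))\quad\text{for all }t\ge0,\ y\in M,\ \omega\in\Omega,$$ where $\mathrm{d}\Phi(t,y,\omega)\colon T_yM\to T_{\Phi(t,y,\omega)}M$ is the tangent map of $\Phi(t,\cdot,\omega)$ at $y$.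
   Context: **Stochastic system.** Let $N\ge 2$, $k>0$ (the coupling coefficient), $\alpha_i\in\mathbb{R}$, $\epsilon_i>0$ ($1\le i\le N$). Let $L$ be the $N\times N$ matrix with $L_{11}=0$, $L_{ii}=-1$ and $L_{i,i-1}=1$ for $2\le i\le N$, all other entries $0$. The stochastic system is $\mathrm{d}\psi=kL\psi\,\mathrm{d}t+(\alpha_i-\sin\psi_i)_{i=1}^N\,\mathrm{d}t+(\epsilon_i\,\mathrm{d}W_i(t))_{i=1}^N$, with $(W_i)_{i=1}^N$ a standard $N$-dimensional two-sided Brownian motion. **Probability space.** $\bar\Omega=\{\omega=(\omega_1,\dots,\omega_N)\colon\mathbb{R}\to\mathbb{R}^N \text{ continuous},\ \omega(0)=0\}$ with the compact-open topology, its Borel $\sigma$-algebra $\bar{\mathcal{F}}$, the Wiener measure $\mathbb{P}$, and the shift $\theta_t\omega(\cdot)=\omega(\cdot+t)-\omega(t)$. Let $\Omega\subset\bar\Omega$ be a fixed $\theta_t$-invariant set with $\mathbb{P}(\Omega)=1$ such that, for every $\omega\in\Omega$ and $1\le i\le N$, $z_i(\omega)=-\epsilon_i\int_{-\infty}^0e^{\tau}\omega_i(\tau)\,\mathrm{d}\tau$ exists, $t\mapsto z_i(\theta_t\omega)$ is continuous (it is the stationary solution of $\mathrm{d}z_i+z_i\,\mathrm{d}t=\epsilon_i\,\mathrm{d}W_i$), and $|z_i(\theta_t\omega)|/t\to0$ as $t\to\pm\infty$. Put $\mathcal{F}=\{F\cap\Omega\mid F\in\bar{\mathcal{F}}\}$.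 **The random system $\phi$ on $\mathbb{R}^N$.** $\phi(t,\phi_0,\omega)$ ($t\in\mathbb{R}$) is the solution with $\phi(0,\phi_0,\omega)=\phi_0$ of $$\frac{\mathrm{d}\phi}{\mathrm{d}t}=kL\phi+\big(\alpha_i-\sin(\phi_i+z_i(\theta_t\omega))+H_i(\theta_t\omega)\big)_{i=1}^N,$$ where $H_1=z_1$ and $H_i=k(z_{i-1}-z_i)+z_i$ for $2\le i\le N$. (It results from $\phi=\psi-z$.) **The random system $\Phi$ on $M$.** $\mathbf{e}=(1,\dots,1)^\top$, $M=\mathbb{R}^N/\mathbb{Z}\cdot2\pi\mathbf{e}$ (a smooth manifold diffeomorphic to $\mathbb{S}^1\times\mathbb{R}^{N-1}$); each $T_yM$ is identified with $\mathbb{R}^N$ via the quotient map, and $\delta y_i$ denotes the $i$-th component of $\delta y$. Since $\phi(t,\phi_0+2\pi\mathbf{e},\omega)=\phi(t,\phi_0,\omega)+2\pi\mathbf{e}$, the formula $\Phi(t,\phi_0\bmod2\pi\mathbf{e},\omega)=\phi(t,\phi_0,\omega)\bmod2\pi\mathbf{e}$ defines a $C^1$-random dynamical system on $M$ over $(\Omega,\mathcal{F},\mathbb{P},(\theta_t))$. **Cone fields.** A random cone field on $M$ assigns to each $(\omega,y)\in\Omega\times M$ a closed convex cone in $T_yM$, where a closed convex cone is a nonempty closed set $C$ with $C+C\subset C$, $\lambda C\subset C$ for $\lambda\ge0$, and $C\cap(-C)=\{0\}$; in local coordinates it is given by inequalities $g_j(y,\delta y,\omega)\ge0$ with $g_j$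 continuous in $(y,\delta y)$ and measurable in $\omega$. The field $\mathcal{C}_M$ of the claim is introduced as a random cone field refining (contained in) the standard one, $\mathsf{C}_M^\omega(y)=\{\delta y\in T_yM\mid\delta y\in\mathbb{R}^N_+\}$, where $\mathbb{R}^N_+$ is the nonnegative orthant. *)

theory Defs
  imports "HOL-Probability.Probability"
begin

text \<open>
  The dimension \<open>N\<close> is \<open>CARD('n)\<close>. A bijection \<open>idx :: 'n \<Rightarrow> nat\<close> onto \<open>{1..N}\<close> numbers the
  coordinates of \<open>real ^ 'n\<close>, so that the chain structure \<open>i - 1 \<rightarrow> i\<close> can be expressed.
  Families indexed by \<open>1 \<le> i \<le> N\<close> are functions on \<open>nat\<close>.
\<close>

definition coord :: "('n::finite \<Rightarrow> nat) \<Rightarrow> real ^ 'n \<Rightarrow> nat \<Rightarrow> real" where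
  "coord idx v i = v $ (inv idx i)"

definition of_coords :: "('n::finite \<Rightarrow> nat) \<Rightarrow> (nat \<Rightarrow> real) \<Rightarrow> real ^ 'n" where
  "of_coords idx f = (\<chi> a. f (idx a))"

definition coupling_matrix :: "('n::finite \<Rightarrow> nat) \<Rightarrow> real ^ 'n ^ 'n" where
  "coupling_matrix idx =
     (\<chi> a b. if 2 \<le> idx a \<and> idx b = idx a then -1
            else if 2 \<le> idx a \<and> idx b = idx a - 1 then 1 else 0)"

subsection \<open>Wiener space\<close>

type_synonym 'n path = "real \<Rightarrow> real ^ 'n"

definition path_space :: "('n::finite) path set" where
  "path_space = {\<omega>. continuous_on UNIV \<omega> \<and> \<omega> 0 = 0}"

definition compact_open_topology :: "('n::finite) path topology" where
  "compact_open_topology =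
     topology_generated_by {{\<omega> \<in> path_space. \<omega> ` K \<subseteq> U} | K U. compact K \<and> open U}"

definition path_borel :: "('n::finite) path measure" where
  "path_borel = sigma path_space {A. openin compact_open_topology A}"

text \<open>
  The law of a standard two-sided Brownian motion in \<open>\<real>\<^sup>N\<close>: all component increments over
  consecutive time intervals of the real line are independent, those over \<open>[s, t]\<close> being
  normally distributed with mean \<open>0\<close> and variance \<open>t - s\<close>.
\<close>

definition wiener_measure :: "('n::finite) path measure \<Rightarrow> bool" where
  "wiener_measure P \<longleftrightarrow>
     prob_space P \<and> sets P = sets (path_borel :: 'n path measure) \<and>
     (\<forall>(m::nat) (t::nat \<Rightarrow> real). (\<forall>j<m. t j < t (Suc j)) \<longrightarrow>
        prob_space.indep_vars P (\<lambda>_. borel)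
          (\<lambda>(a, j) \<omega>. \<omega> (t (Suc j)) $ a - \<omega> (t j) $ a) (UNIV \<times> {..<m})) \<and>
     (\<forall>(s::real) (t::real) (a::'n). s < t \<longrightarrow>
        distributed P lborel (\<lambda>\<omega>. \<omega> t $ a - \<omega> s $ a) (normal_density 0 (sqrt (t - s))))"

definition shift :: "real \<Rightarrow> ('n::finite) path \<Rightarrow> 'n path" where
  "shift t \<omega> = (\<lambda>s. \<omega> (s + t) - \<omega> t)"

definition ou :: "('n::finite \<Rightarrow> nat) \<Rightarrow> (nat \<Rightarrow> real) \<Rightarrow> nat \<Rightarrow> 'n path \<Rightarrow> real" where
  "ou idx \<epsilon> i \<omega> = - \<epsilon> i * integral {..0} (\<lambda>\<tau>. exp \<tau> * coord idx (\<omega> \<tau>) i)"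

text \<open>Integrability is in the Henstock--Kurzweil sense, which covers improper integrals.\<close>

definition full_path_set ::
    "('n::finite \<Rightarrow> nat) \<Rightarrow> (nat \<Rightarrow> real) \<Rightarrow> 'n path measure \<Rightarrow> 'n path set \<Rightarrow> bool" where
  "full_path_set idx \<epsilon> P \<Omega> \<longleftrightarrow>
     \<Omega> \<in> sets P \<and> measure P \<Omega> = 1 \<and> (\<forall>t. shift t ` \<Omega> = \<Omega>) \<and>
     (\<forall>\<omega>\<in>\<Omega>. \<forall>i\<in>{1..CARD('n)}.
        (\<lambda>\<tau>. exp \<tau> * coord idx (\<omega> \<tau>) i) integrable_on {..0} \<and>
        continuous_on UNIV (\<lambda>t. ou idx \<epsilon> i (shift t \<omega>)) \<and>
        ((\<lambda>t. \<bar>ou idx \<epsilon> i (shift t \<omega>)\<bar> / t) \<longlongrightarrow> 0) at_top \<and>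
        ((\<lambda>t. \<bar>ou idx \<epsilon> i (shift t \<omega>)\<bar> / t) \<longlongrightarrow> 0) at_bot)"

subsection \<open>The random system on \<open>\<real>\<^sup>N\<close>\<close>

definition drift_correction ::
    "('n::finite \<Rightarrow> nat) \<Rightarrow> real \<Rightarrow> (nat \<Rightarrow> real) \<Rightarrow> nat \<Rightarrow> 'n path \<Rightarrow> real" where
  "drift_correction idx k \<epsilon> i \<omega> =
     (if i = 1 then ou idx \<epsilon> 1 \<omega>
      else k * (ou idx \<epsilon> (i - 1) \<omega> - ou idx \<epsilon> i \<omega>) + ou idx \<epsilon> i \<omega>)"

definition random_field ::
    "('n::finite \<Rightarrow> nat) \<Rightarrow> real \<Rightarrow> (nat \<Rightarrow> real) \<Rightarrow> (nat \<Rightarrow> real) \<Rightarrow> 'n path \<Rightarrow> real ^ 'n \<Rightarrow> real ^ 'n" where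
  "random_field idx k \<alpha> \<epsilon> \<omega> x =
     k *\<^sub>R (coupling_matrix idx *v x) +
     of_coords idx (\<lambda>i. \<alpha> i - sin (coord idx x i + ou idx \<epsilon> i \<omega>) + drift_correction idx k \<epsilon> i \<omega>)"

definition random_flow ::
    "('n::finite \<Rightarrow> nat) \<Rightarrow> real \<Rightarrow> (nat \<Rightarrow> real) \<Rightarrow> (nat \<Rightarrow> real) \<Rightarrow> 'n path set
      \<Rightarrow> (real \<Rightarrow> real ^ 'n \<Rightarrow> 'n path \<Rightarrow> real ^ 'n) \<Rightarrow> bool" where
  "random_flow idx k \<alpha> \<epsilon> \<Omega> \<phi> \<longleftrightarrow>
     (\<forall>\<omega>\<in>\<Omega>. \<forall>x. \<phi> 0 x \<omega> = x \<and>
        (\<forall>t. ((\<lambda>s. \<phi> s x \<omega>) has_vector_derivative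
               random_field idx k \<alpha> \<epsilon> (shift t \<omega>) (\<phi> t x \<omega>)) (at t)))"

subsection \<open>The manifold \<open>M\<close>\<close>

definition lattice_rel :: "real ^ 'n::finite \<Rightarrow> real ^ 'n \<Rightarrow> bool" where
  "lattice_rel x y \<longleftrightarrow> (\<exists>m::int. x - y = (2 * pi * of_int m) *\<^sub>R (\<chi> a. 1))"

lemma equivp_lattice_rel: "equivp (lattice_rel :: real ^ 'n::finite \<Rightarrow> _)"
proof (rule equivpI)
  show "reflp (lattice_rel :: real ^ 'n \<Rightarrow> _)"
    unfolding reflp_def lattice_rel_def by (auto intro: exI[of _ 0])
  show "symp (lattice_rel :: real ^ 'n \<Rightarrow> _)"
  proof (rule sympI)
    fix x y :: "real ^ 'n" assume "lattice_rel x y"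
    then obtain m :: int where "x - y = (2 * pi * of_int m) *\<^sub>R (\<chi> a. 1)"
      unfolding lattice_rel_def by blast
    then have "y - x = (2 * pi * of_int (- m)) *\<^sub>R (\<chi> a. 1)"
      by (metis minus_diff_eq mult_minus_right of_int_minus scaleR_minus_left)
    then show "lattice_rel y x" unfolding lattice_rel_def by blast
  qed
  show "transp (lattice_rel :: real ^ 'n \<Rightarrow> _)"
  proof (rule transpI)
    fix x y z :: "real ^ 'n" assume "lattice_rel x y" "lattice_rel y z"
    then obtain m m' :: int where "x - y = (2 * pi * of_int m) *\<^sub>R (\<chi> a. 1)"
      and "y - z = (2 * pi * of_int m') *\<^sub>R (\<chi> a. 1)"
      unfolding lattice_rel_def by blast
    then have "x - z = (2 * pi * of_int (m + m')) *\<^sub>R (\<chi> a. 1)"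
      by (simp add: algebra_simps flip: scaleR_add_left)
    then show "lattice_rel x z" unfolding lattice_rel_def by blast
  qed
qed

quotient_type (overloaded) 'n cylinder = "real ^ 'n::finite" / lattice_rel
  by (rule equivp_lattice_rel)

definition proj :: "real ^ 'n::finite \<Rightarrow> 'n cylinder" where
  "proj = abs_cylinder"

lemma proj_eq_iff: "proj x = proj y \<longleftrightarrow> lattice_rel x y"
  unfolding proj_def by (simp add: cylinder.abs_eq_iff)

lemma surj_proj: "surj proj"
  unfolding proj_def using Quotient_cylinder by (metis Quotient_abs_rep surjI)

text \<open>
  The projection is a local diffeomorphism that identifies each tangent space of \<open>M\<close> with
  \<open>\<real>\<^sup>N\<close>; local inverses of it are charts. In these charts \<open>F\<close> is a local lift \<open>g\<close>, and its tangent
  map is the derivative of \<open>g\<close>. Two local lifts that are continuous at \<open>x\<close> differ near \<open>x\<close> by a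
  constant lattice vector, so that the derivative does not depend on the choices.
\<close>

definition has_tangent_map ::
    "('n::finite cylinder \<Rightarrow> 'n cylinder) \<Rightarrow> (real ^ 'n \<Rightarrow> real ^ 'n) \<Rightarrow> 'n cylinder \<Rightarrow> bool" where
  "has_tangent_map F D y \<longleftrightarrow>
     (\<exists>x g. proj x = y \<and> (\<forall>\<^sub>F x' in nhds x. proj (g x') = F (proj x')) \<and>
            (g has_derivative D) (at x))"

definition tangent_map ::
    "('n::finite cylinder \<Rightarrow> 'n cylinder) \<Rightarrow> 'n cylinder \<Rightarrow> real ^ 'n \<Rightarrow> real ^ 'n" where
  "tangent_map F y = (SOME D. has_tangent_map F D y)"

subsection \<open>Cone fields\<close>

text \<open>A cone field assigns to \<open>\<omega>\<close> and \<open>y\<close> a subset of the tangent space at \<open>y\<close>.\<close>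

type_synonym 'n cone_field = "'n path \<Rightarrow> 'n cylinder \<Rightarrow> (real ^ 'n) set"

definition closed_convex_cone :: "(real ^ 'n::finite) set \<Rightarrow> bool" where
  "closed_convex_cone C \<longleftrightarrow>
     C \<noteq> {} \<and> closed C \<and> (\<forall>u\<in>C. \<forall>v\<in>C. u + v \<in> C) \<and>
     (\<forall>c\<ge>0. \<forall>u\<in>C. c *\<^sub>R u \<in> C) \<and> C \<inter> uminus ` C = {0}"

definition standard_cone_field :: "'n::finite cone_field" where
  "standard_cone_field \<omega> y = {v. \<forall>a. 0 \<le> v $ a}"

definition gamma_coeff :: "real \<Rightarrow> nat \<Rightarrow> real" where
  "gamma_coeff k i = inverse (1 + 2 * real i * inverse k)"

text \<open>Meaningful only where \<open>1 - 2 i / k\<close> does not vanish.\<close>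

definition beta_coeff :: "real \<Rightarrow> nat \<Rightarrow> real" where
  "beta_coeff k i = inverse (1 - 2 * real i * inverse k)"

definition chain_cone_field :: "('n::finite \<Rightarrow> nat) \<Rightarrow> real \<Rightarrow> 'n cone_field" where
  "chain_cone_field idx k \<omega> y =
     {v. \<forall>i\<in>{1..CARD('n) - 1}.
           coord idx v (i + 1) - gamma_coeff k i * coord idx v i \<ge> 0 \<and>
           beta_coeff k i * coord idx v i - coord idx v (i + 1) \<ge> 0}"

definition cone_field_refines :: "'n::finite path set \<Rightarrow> 'n cone_field \<Rightarrow> 'n cone_field \<Rightarrow> bool" where
  "cone_field_refines \<Omega> C C' \<longleftrightarrow> (\<forall>\<omega>\<in>\<Omega>. \<forall>y. C \<omega> y \<subseteq> C' \<omega> y)"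

definition differentially_positive ::
    "'n::finite path set \<Rightarrow> (real \<Rightarrow> 'n cylinder \<Rightarrow> 'n path \<Rightarrow> 'n cylinder) \<Rightarrow> 'n cone_field \<Rightarrow> bool" where
  "differentially_positive \<Omega> \<Phi> C \<longleftrightarrow>
     (\<forall>t\<ge>0. \<forall>y. \<forall>\<omega>\<in>\<Omega>.
        tangent_map (\<lambda>y'. \<Phi> t y' \<omega>) y ` C \<omega> y \<subseteq> C (shift t \<omega>) (\<Phi> t y \<omega>))"

lemma coord_idx:
  assumes "bij_betw idx (UNIV :: 'n::finite set) {1..CARD('n)}"
  shows "coord idx v (idx a) = v $ a"
  using assms unfolding coord_def bij_betw_def by (simp add: inv_f_f)

text \<open>For \<open>k > 2 (N - 1)\<close> the cone field refines the standard one.\<close>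

lemma chain_cone_field_refines:
  fixes idx :: "'n::finite \<Rightarrow> nat"
  assumes N: "2 \<le> CARD('n)" and idx: "bij_betw idx UNIV {1..CARD('n)}"
    and k: "k > 2 * real (CARD('n) - 1)"
  shows "cone_field_refines \<Omega> (chain_cone_field idx k) standard_cone_field"
proof -
  have k0: "k > 0" using k by linarith
  have main: "0 \<le> v $ a" if v: "v \<in> chain_cone_field idx k \<omega> y" for v \<omega> y a
  proof -
    have c: "coord idx v (i + 1) \<ge> gamma_coeff k i * coord idx v i"
            "beta_coeff k i * coord idx v i \<ge> coord idx v (i + 1)"
      if "1 \<le> i" "i \<le> CARD('n) - 1" for i
      using v that unfolding chain_cone_field_def by auto
    have g: "gamma_coeff k i > 0" for i
      unfolding gamma_coeff_def using k0 by (simp add: add_pos_nonneg)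
    have nn: "coord idx v i \<ge> 0" if i: "1 \<le> i" "i \<le> CARD('n) - 1" for i
    proof -
      have "2 * real i < k" using i k
        by (smt (verit) of_nat_le_iff)
      then have b: "0 < 1 - 2 * real i * inverse k" "1 - 2 * real i * inverse k < 1"
        using k0 i by (auto simp: field_simps)
      have "1 < beta_coeff k i" unfolding beta_coeff_def
        using b by (rule one_less_inverse)
      moreover have "gamma_coeff k i \<le> 1" unfolding gamma_coeff_def
        using k0 by (intro inverse_le_1_iff[THEN iffD2]) auto
      moreover have "0 \<le> (beta_coeff k i - gamma_coeff k i) * coord idx v i"
        using c[OF i] by (simp add: algebra_simps)
      ultimately show ?thesis by (simp add: zero_le_mult_iff)
    qed
    have "idx a \<in> {1..CARD('n)}" using idx by (auto simp: bij_betw_def)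
    then consider "1 \<le> idx a" "idx a \<le> CARD('n) - 1" | "idx a = CARD('n)" by fastforce
    then have "coord idx v (idx a) \<ge> 0"
    proof cases
      case 1 then show ?thesis by (rule nn)
    next
      case 2
      have i: "1 \<le> CARD('n) - 1" "CARD('n) - 1 + 1 = CARD('n)" using N by auto
      have "0 \<le> gamma_coeff k (CARD('n) - 1) * coord idx v (CARD('n) - 1)"
        using nn[OF i(1)] g[of "CARD('n) - 1"] by simp
      then show ?thesis using c(1)[OF i(1)] i(2) 2 by simp
    qed
    then show ?thesis using coord_idx[OF idx] by metis
  qed
  then show ?thesis unfolding cone_field_refines_def standard_cone_field_def by blast
qed

lemma closed_convex_cone_chain:
  assumes "cone_field_refines \<Omega> (chain_cone_field idx k) standard_cone_field" and "\<omega> \<in> \<Omega>"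
  shows "closed_convex_cone (chain_cone_field idx k \<omega> y)" (is "closed_convex_cone ?C")
  unfolding closed_convex_cone_def
proof (intro conjI ballI allI impI)
  have zero: "0 \<in> ?C" unfolding chain_cone_field_def coord_def by simp
  then show "?C \<noteq> {}" by blast
  show "closed ?C"
    unfolding chain_cone_field_def coord_def Ball_def
    by (intro closed_Collect_all closed_Collect_imp closed_Collect_conj closed_Collect_le
        continuous_intros open_Collect_const)
  show "u + v \<in> ?C" if "u \<in> ?C" "v \<in> ?C" for u v
    using that unfolding chain_cone_field_def coord_def by (fastforce simp: algebra_simps)
  show "c *\<^sub>R u \<in> ?C" if c: "0 \<le> c" and u: "u \<in> ?C" for c u
  proof -
    have "r * (c * p) \<le> c * q" if "r * p \<le> q" for r p q :: real
      using mult_left_mono[OF that c] by (simp add: mult.left_commute)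
    moreover have "c * q \<le> r * (c * p)" if "q \<le> r * p" for r p q :: real
      using mult_left_mono[OF that c] by (simp add: mult.left_commute)
    ultimately show ?thesis using u unfolding chain_cone_field_def coord_def by simp
  qed
  have std: "0 \<le> v $ a" if "v \<in> ?C" for v a
    using that assms unfolding cone_field_refines_def standard_cone_field_def by blast
  have "v = 0" if "v \<in> ?C" "- v \<in> ?C" for v
    using std[OF that(1)] std[OF that(2)] by (simp add: vec_eq_iff order_antisym)
  then show "?C \<inter> uminus ` ?C = {0}" using zero by (auto simp: image_iff)
qed

end

theory Submission
  imports Defs
begin

text \<open>
  The difference \<open>r\<close> of two solutions of the random system solves
  \<open>r\<^sub>i' = k (r\<^sub>i\<^sub>-\<^sub>1 - r\<^sub>i) - D\<^sub>i\<close> with \<open>D\<^sub>i\<close> a difference of sines, so \<open>\<bar>D\<^sub>i\<bar> \<le> \<bar>r\<^sub>i\<bar>\<close>. The cone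
  inequalities for the pair \<open>(i - 1, i)\<close> bound \<open>k \<bar>r\<^sub>i\<^sub>-\<^sub>1 - r\<^sub>i\<bar>\<close> by \<open>2 (i - 1) r\<^sub>i\<close>, and the choice
  of \<open>\<gamma>\<^sub>i\<close> and \<open>\<beta>\<^sub>i\<close> is exactly what makes the defects \<open>r\<^sub>i\<^sub>+\<^sub>1 - \<gamma>\<^sub>i r\<^sub>i\<close> and \<open>\<beta>\<^sub>i r\<^sub>i - r\<^sub>i\<^sub>+\<^sub>1\<close>
  nondecreasing wherever they are negative; so the cone is invariant by induction on \<open>i\<close>, already
  for finite differences, and hence for the derivative. Since the chain is unidirectional,
  differentiability of the flow is obtained one coordinate at a time, from scalar linear equations
  and a quadratic error bound.
\<close>

section \<open>Scalar differential inequalities and linear equations\<close>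

text \<open>Follow \<open>y\<close> back from a negative value to the last time \<open>a\<close> at
  which it was nonnegative. Past \<open>a\<close> the inequality applies, so
  \<open>y s * exp (- K * s)\<close> is nondecreasing there and cannot turn negative. Asking for the
  inequality only at negative values makes this an invariance criterion for the cone
  defects.\<close>

lemma nonneg_of_derivative_ge:
  fixes y y' :: "real \<Rightarrow> real"
  assumes der: "\<And>s. s \<in> {0..T} \<Longrightarrow> (y has_real_derivative y' s) (at s within {0..T})"
    and y0: "0 \<le> y 0"
    and ge: "\<And>s. s \<in> {0..T} \<Longrightarrow> y s < 0 \<Longrightarrow> K * y s \<le> y' s"
    and t: "t \<in> {0..T}"
  shows "0 \<le> y t"
proof (rule ccontr)
  assume "\<not> 0 \<le> y t"
  then have neg: "y t < 0" by simp
  have cont: "continuous_on {0..T} y"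
    using der by (meson DERIV_continuous continuous_on_eq_continuous_within)
  define S where "S = {s \<in> {0..t}. 0 \<le> y s}"
  have "S = {0..t} \<inter> y -` {0..}" by (auto simp: S_def)
  moreover have "continuous_on {0..t} y" using t by (intro continuous_on_subset[OF cont]) auto
  ultimately have "closed S" by (simp add: continuous_closed_preimage)
  moreover have "bounded S" by (rule bounded_subset[of "{0..t}"]) (auto simp: S_def)
  ultimately have "compact S" by (simp add: compact_eq_bounded_closed)
  moreover have "0 \<in> S" using t y0 by (simp add: S_def)
  ultimately obtain a where a: "a \<in> S" and a_max: "\<And>s. s \<in> S \<Longrightarrow> s \<le> a"
    using compact_attains_sup[of S] by blast
  have at: "0 \<le> a" "a < t" "0 \<le> y a" and sub: "{a..t} \<subseteq> {0..T}"
    using a neg t by (auto simp: S_def order_less_le)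
  define h where "h s = y s * exp (- K * s)" for s
  have hder: "(h has_real_derivative (y' s - K * y s) * exp (- K * s)) (at s)"
    if "a < s" "s < t" for s
  proof -
    have "(y has_real_derivative y' s) (at s)"
      using der[of s] that at t by (auto simp: at_within_Icc_at)
    then show ?thesis unfolding h_def
      by (auto intro!: derivative_eq_intros simp: algebra_simps)
  qed
  have "continuous_on {a..t} h" unfolding h_def
    by (intro continuous_intros continuous_on_subset[OF cont sub])
  with at hder obtain c where c: "a < c" "c < t"
    and "h t - h a = (t - a) * ((y' c - K * y c) * exp (- K * c))"
    using mvt[of a t h "\<lambda>s. (*) ((y' s - K * y s) * exp (- K * s))"]
    unfolding has_field_derivative_def by (metis mult.commute)
  moreover have "y c < 0" using a_max[of c] c at by (force simp: S_def)
  then have "0 \<le> y' c - K * y c" using ge[of c] c at t by auto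
  ultimately have "0 \<le> h t - h a" using at by simp
  moreover have "0 \<le> h a" "h t < 0" using at neg by (simp_all add: h_def mult_neg_pos)
  ultimately show False by simp
qed

text \<open>Comparison with \<open>b s = (\<bar>y 0\<bar> + F * s) * exp (K * s)\<close>, whose
  derivative is at least \<open>K * b s + F\<close>: both \<open>b - y\<close> and
  \<open>b + y\<close> stay nonnegative.\<close>

lemma scalar_gronwall:
  fixes y y' :: "real \<Rightarrow> real"
  assumes der: "\<And>s. s \<in> {0..T} \<Longrightarrow> (y has_real_derivative y' s) (at s within {0..T})"
    and bound: "\<And>s. s \<in> {0..T} \<Longrightarrow> \<bar>y' s\<bar> \<le> K * \<bar>y s\<bar> + F"
    and K: "0 \<le> K" and F: "0 \<le> F" and t: "t \<in> {0..T}"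
  shows "\<bar>y t\<bar> \<le> (\<bar>y 0\<bar> + F * T) * exp (K * T)"
proof -
  define b where "b s = (\<bar>y 0\<bar> + F * s) * exp (K * s)" for s
  have bder: "(b has_real_derivative K * b s + F * exp (K * s)) (at s within {0..T})" for s
    unfolding b_def by (auto intro!: derivative_eq_intros simp: algebra_simps)
  have b0: "0 \<le> b s" "F \<le> F * exp (K * s)" if "s \<in> {0..T}" for s
    using that K F mult_left_mono[of 1 "exp (K * s)" F] by (auto simp: b_def)
  have main: "0 \<le> b t - \<sigma> * y t" if \<sigma>: "\<sigma> = 1 \<or> \<sigma> = -1" for \<sigma> :: real
  proof (rule nonneg_of_derivative_ge[where y = "\<lambda>s. b s - \<sigma> * y s"])
    show "((\<lambda>s. b s - \<sigma> * y s) has_real_derivative K * b s + F * exp (K * s) - \<sigma> * y' s)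
        (at s within {0..T})" if "s \<in> {0..T}" for s
      by (intro derivative_intros bder der that DERIV_cmult)
    show "0 \<le> b 0 - \<sigma> * y 0" using \<sigma> by (auto simp: b_def)
    show "K * (b s - \<sigma> * y s) \<le> K * b s + F * exp (K * s) - \<sigma> * y' s"
      if s: "s \<in> {0..T}" and neg: "b s - \<sigma> * y s < 0" for s
    proof -
      \<comment> \<open>A negative \<open>b s - \<sigma> * y s\<close> forces
        \<open>\<sigma> * y s\<close> above \<open>b s\<close>, hence positive, which removes the
        absolute value from the growth bound.\<close>
      have "\<bar>y s\<bar> = \<sigma> * y s" using \<sigma> neg b0(1)[OF s] by auto
      moreover have "\<sigma> * y' s \<le> \<bar>y' s\<bar>" using \<sigma> by auto
      ultimately show ?thesis using bound[OF s] b0(2)[OF s] by (simp add: algebra_simps)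
    qed
  qed (rule t)
  have "\<bar>y t\<bar> \<le> b t" using main[of 1] main[of "-1"] by auto
  also have "\<dots> \<le> (\<bar>y 0\<bar> + F * T) * exp (K * T)"
    unfolding b_def using t K F
    by (intro mult_mono add_left_mono mult_left_mono) (auto intro: mult_left_mono)
  finally show ?thesis .
qed

text \<open>Variation of constants: with \<open>A\<close> the primitive of \<open>a\<close>, the
  solution is \<open>exp (A s)\<close> times the sum of \<open>l v\<close> and the integral of
  \<open>exp (- A)\<close> times \<open>f\<close>. This formula makes linearity in \<open>v\<close>
  visible, as a derivative in the initial value requires.\<close>

lemma linear_scalar_ode_solution:
  fixes a :: "real \<Rightarrow> real" and f :: "real \<Rightarrow> 'v::real_vector \<Rightarrow> real"
  assumes a: "continuous_on {0..T} a"
    and f: "\<And>v. continuous_on {0..T} (\<lambda>s. f s v)" "\<And>s. s \<in> {0..T} \<Longrightarrow> linear (f s)"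
    and l: "linear l"
  obtains W where "\<And>s. s \<in> {0..T} \<Longrightarrow> linear (W s)" "\<And>v. W 0 v = l v"
    and "\<And>s v. s \<in> {0..T} \<Longrightarrow>
      ((\<lambda>s. W s v) has_real_derivative a s * W s v + f s v) (at s within {0..T})"
proof -
  define A where "A s = integral {0..s} a" for s
  have A: "(A has_real_derivative a s) (at s within {0..T})" if "s \<in> {0..T}" for s
    using integral_has_vector_derivative[OF a that] unfolding A_def
    by (simp add: has_real_derivative_iff_has_vector_derivative)
  have Ac: "continuous_on {0..T} A"
    using A by (meson DERIV_continuous continuous_on_eq_continuous_within)
  define g where "g s v = exp (- A s) * f s v" for s v
  have gc: "continuous_on {0..T} (\<lambda>s. g s v)" for v
    unfolding g_def by (intro continuous_intros Ac f)
  have gi: "(\<lambda>s. g s v) integrable_on {0..s}" if "s \<in> {0..T}" for s v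
    using that by (intro integrable_continuous_real continuous_on_subset[OF gc]) auto
  define G where "G s v = integral {0..s} (\<lambda>s. g s v)" for s v
  have G: "((\<lambda>s. G s v) has_real_derivative g s v) (at s within {0..T})" if "s \<in> {0..T}" for s v
    using integral_has_vector_derivative[OF gc that] unfolding G_def
    by (simp add: has_real_derivative_iff_has_vector_derivative)
  have Glin: "linear (G s)" if s: "s \<in> {0..T}" for s
  proof (rule linearI)
    show "G s (u + v) = G s u + G s v" for u v
    proof -
      have "G s (u + v) = integral {0..s} (\<lambda>\<tau>. g \<tau> u + g \<tau> v)" unfolding G_def
        using s by (intro integral_cong) (auto simp: g_def algebra_simps linear_add[OF f(2)])
      then show ?thesis unfolding G_def using integral_add[OF gi[OF s] gi[OF s]] by simp
    qed
    show "G s (c *\<^sub>R v) = c *\<^sub>R G s v" for c v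
    proof -
      have "G s (c *\<^sub>R v) = integral {0..s} (\<lambda>\<tau>. c * g \<tau> v)" unfolding G_def
        using s by (intro integral_cong) (auto simp: g_def algebra_simps linear_cmul[OF f(2)])
      then show ?thesis unfolding G_def by simp
    qed
  qed
  define W where "W s v = exp (A s) * (l v + G s v)" for s v
  show ?thesis
  proof
    show "linear (W s)" if "s \<in> {0..T}" for s
      unfolding W_def using Glin[OF that] l
      by (intro linearI) (simp_all add: linear_add linear_cmul algebra_simps)
    show "W 0 v = l v" for v unfolding W_def A_def G_def by simp
    show "((\<lambda>s. W s v) has_real_derivative a s * W s v + f s v) (at s within {0..T})"
      if s: "s \<in> {0..T}" for s v
    proof -
      have "((\<lambda>s. W s v) has_real_derivative
          exp (A s) * a s * (l v + G s v) + g s v * exp (A s)) (at s within {0..T})"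
        unfolding W_def
        by (auto intro!: derivative_eq_intros A[OF s] G[OF s])
      moreover have "g s v * exp (A s) = f s v" unfolding g_def by (simp add: exp_minus)
      ultimately show ?thesis by (simp add: W_def algebra_simps)
    qed
  qed
qed

section \<open>First and second order bounds for the sine\<close>

lemma abs_sin_diff_le: "\<bar>sin a - sin b\<bar> \<le> \<bar>a - b\<bar>" for a b :: real
proof -
  have "\<bar>sin a - sin b\<bar> = 2 * \<bar>sin ((a - b) / 2)\<bar> * \<bar>cos ((a + b) / 2)\<bar>"
    unfolding sin_diff_sin by (simp add: abs_mult)
  also have "\<dots> \<le> 2 * \<bar>(a - b) / 2\<bar> * 1"
    by (intro mult_mono mult_left_mono abs_sin_x_le_abs_x) auto
  finally show ?thesis by simp
qed

text \<open>The mean value theorem gives \<open>(a - b) * cos z\<close> with \<open>z\<close> no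
  farther from \<open>b\<close> than \<open>a\<close> is, and the cosine is 1-Lipschitz. The
  constant 1 instead of the optimal 1/2 is enough for a quadratic error.\<close>

lemma abs_sin_diff_linear_le: "\<bar>sin a - sin b - cos b * (a - b)\<bar> \<le> (a - b)\<^sup>2" for a b :: real
proof -
  obtain z where z: "\<bar>z - b\<bar> \<le> \<bar>a - b\<bar>" "sin a - sin b = (a - b) * cos z"
  proof (cases a b rule: linorder_cases)
    case less
    then obtain z where "a < z" "z < b" "sin b - sin a = (b - a) * cos z"
      using MVT2[of a b sin cos] DERIV_sin by blast
    then show ?thesis by (intro that[of z]) (auto simp: algebra_simps)
  next
    case greater
    then obtain z where "b < z" "z < a" "sin a - sin b = (a - b) * cos z"
      using MVT2[of b a sin cos] DERIV_sin by blast
    then show ?thesis by (intro that[of z]) auto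
  qed (use that in auto)
  have "\<bar>cos z - cos b\<bar> = \<bar>sin (pi / 2 - z) - sin (pi / 2 - b)\<bar>" by (simp add: sin_diff)
  also have "\<dots> \<le> \<bar>z - b\<bar>" using abs_sin_diff_le[of "pi / 2 - z" "pi / 2 - b"] by simp
  finally have "\<bar>a - b\<bar> * \<bar>cos z - cos b\<bar> \<le> \<bar>a - b\<bar> * \<bar>a - b\<bar>"
    using z by (intro mult_left_mono) auto
  moreover have "sin a - sin b - cos b * (a - b) = (a - b) * (cos z - cos b)"
    using z by (simp add: algebra_simps)
  ultimately show ?thesis by (simp add: abs_mult power2_eq_square)
qed

section \<open>Differentiability in the initial value, one coordinate at a time\<close>

text \<open>\<open>R s v\<close> stands for the change of one coordinate at time \<open>s\<close>
  when the initial point moves by \<open>v\<close>, and \<open>W s\<close> for its linear part. The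
  linear bound on \<open>R\<close> and the continuity of \<open>W\<close> in time are included
  because both enter as forcing in the equation of the next coordinate.\<close>

definition quadratic_approx ::
    "real \<Rightarrow> (real \<Rightarrow> 'v::real_normed_vector \<Rightarrow> real) \<Rightarrow> (real \<Rightarrow> 'v \<Rightarrow> real) \<Rightarrow> bool" where
  "quadratic_approx T R W \<longleftrightarrow>
     (\<forall>s\<in>{0..T}. linear (W s)) \<and> (\<forall>v. continuous_on {0..T} (\<lambda>s. W s v)) \<and>
     (\<exists>C\<ge>0. \<forall>s\<in>{0..T}. \<forall>v. \<bar>R s v\<bar> \<le> C * norm v \<and> \<bar>R s v - W s v\<bar> \<le> C * (norm v)\<^sup>2)"

text \<open>\<open>W\<close> solves the variational equation
  \<open>W' = m * (W\<^sub>0 - W) - c * W\<close> with initial value \<open>l\<close>. A first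
  Gronwall estimate bounds \<open>R\<close> linearly; a second one, for \<open>R - W\<close>, has
  only forcing of quadratic order.\<close>

lemma quadratic_approx_step:
  fixes R\<^sub>0 R D :: "real \<Rightarrow> 'v::real_normed_vector \<Rightarrow> real" and l :: "'v \<Rightarrow> real"
  assumes approx: "quadratic_approx T R\<^sub>0 W\<^sub>0"
    and der: "\<And>s v. s \<in> {0..T} \<Longrightarrow>
      ((\<lambda>s. R s v) has_real_derivative m * (R\<^sub>0 s v - R s v) - D s v) (at s within {0..T})"
    and D: "\<And>s v. s \<in> {0..T} \<Longrightarrow> \<bar>D s v\<bar> \<le> \<bar>R s v\<bar>"
      "\<And>s v. s \<in> {0..T} \<Longrightarrow> \<bar>D s v - c s * R s v\<bar> \<le> (R s v)\<^sup>2"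
    and c: "continuous_on {0..T} c" "\<And>s. \<bar>c s\<bar> \<le> 1"
    and init: "\<And>v. R 0 v = l v" and l: "linear l" "\<And>v. \<bar>l v\<bar> \<le> norm v"
    and m: "0 \<le> m" and T: "0 \<le> T"
  obtains W where "quadratic_approx T R W"
proof -
  obtain C where C: "C \<ge> 0"
    and R0: "\<And>s v. s \<in> {0..T} \<Longrightarrow> \<bar>R\<^sub>0 s v\<bar> \<le> C * norm v"
    and RW0: "\<And>s v. s \<in> {0..T} \<Longrightarrow> \<bar>R\<^sub>0 s v - W\<^sub>0 s v\<bar> \<le> C * (norm v)\<^sup>2"
    using approx unfolding quadratic_approx_def by blast
  have W0: "\<And>s. s \<in> {0..T} \<Longrightarrow> linear (W\<^sub>0 s)" "\<And>v. continuous_on {0..T} (\<lambda>s. W\<^sub>0 s v)"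
    using approx unfolding quadratic_approx_def by auto
  obtain W where Wlin: "\<And>s. s \<in> {0..T} \<Longrightarrow> linear (W s)" and Wi: "\<And>v. W 0 v = l v"
    and Wd: "\<And>s v. s \<in> {0..T} \<Longrightarrow>
      ((\<lambda>s. W s v) has_real_derivative (- m - c s) * W s v + m * W\<^sub>0 s v) (at s within {0..T})"
  proof (rule linear_scalar_ode_solution[of T "\<lambda>s. - m - c s" "\<lambda>s v. m * W\<^sub>0 s v" l])
    show "continuous_on {0..T} (\<lambda>s. - m - c s)" by (intro continuous_intros c)
    show "continuous_on {0..T} (\<lambda>s. m * W\<^sub>0 s v)" for v by (intro continuous_intros W0)
    show "linear (\<lambda>v. m * W\<^sub>0 s v)" if "s \<in> {0..T}" for s
      using W0(1)[OF that] by (intro linearI) (simp_all add: linear_add linear_cmul algebra_simps)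
  qed (use l in auto)
  \<comment> \<open>Gronwall constants for the rate \<open>m + 1\<close>, coupling plus sine.
    \<open>C1\<close> comes from initial size \<open>norm v\<close> and forcing
    \<open>m * C * norm v\<close>; \<open>C2\<close> from initial value 0 and forcing
    \<open>(m * C + C1\<^sup>2) * (norm v)\<^sup>2\<close>.\<close>
  define E where "E = exp ((m + 1) * T)"
  define C1 where "C1 = (1 + m * C * T) * E"
  define C2 where "C2 = (m * C + C1\<^sup>2) * T * E"
  have nonneg: "0 \<le> C1" "0 \<le> C2" using C m T by (auto simp: C1_def C2_def E_def)
  have R: "\<bar>R t v\<bar> \<le> C1 * norm v" if t: "t \<in> {0..T}" for t v
  proof -
    have "\<bar>R t v\<bar> \<le> (\<bar>R 0 v\<bar> + m * C * norm v * T) * exp ((m + 1) * T)"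
    proof (rule scalar_gronwall[OF der _ _ _ t])
      show "\<bar>m * (R\<^sub>0 s v - R s v) - D s v\<bar> \<le> (m + 1) * \<bar>R s v\<bar> + m * C * norm v"
        if s: "s \<in> {0..T}" for s
      proof -
        have "\<bar>m * (R\<^sub>0 s v - R s v) - D s v\<bar> \<le> \<bar>m * (R\<^sub>0 s v - R s v)\<bar> + \<bar>D s v\<bar>" by linarith
        also have "\<bar>m * (R\<^sub>0 s v - R s v)\<bar> = m * \<bar>R\<^sub>0 s v - R s v\<bar>" using m by (simp add: abs_mult)
        also have "\<dots> \<le> m * (\<bar>R\<^sub>0 s v\<bar> + \<bar>R s v\<bar>)" using m by (intro mult_left_mono) auto
        also have "\<dots> \<le> m * (C * norm v + \<bar>R s v\<bar>)" using m R0[OF s, of v] by (intro mult_left_mono) auto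
        finally show ?thesis using D(1)[OF s, of v] by (simp add: algebra_simps)
      qed
    qed (use m C in auto)
    also have "\<dots> \<le> (norm v + m * C * norm v * T) * exp ((m + 1) * T)"
      using l(2)[of v] init by (intro mult_right_mono) auto
    also have "\<dots> = C1 * norm v" by (simp add: C1_def E_def algebra_simps)
    finally show ?thesis .
  qed
  have RW: "\<bar>R t v - W t v\<bar> \<le> C2 * (norm v)\<^sup>2" if t: "t \<in> {0..T}" for t v
  proof -
    define u where "u s = R s v - W s v" for s
    \<comment> \<open>The derivative of \<open>u\<close>, sorted into the error of the predecessor,
      terms linear in \<open>u\<close>, and the sine remainder.\<close>
    define u' where "u' s = m * (R\<^sub>0 s v - W\<^sub>0 s v) - m * u s - c s * u s - (D s v - c s * R s v)" for s
    have "\<bar>u t\<bar> \<le> (\<bar>u 0\<bar> + (m * C + C1\<^sup>2) * (norm v)\<^sup>2 * T) * exp ((m + 1) * T)"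
    proof (rule scalar_gronwall[OF _ _ _ _ t])
      show "(u has_real_derivative u' s) (at s within {0..T})" if s: "s \<in> {0..T}" for s
        unfolding u_def u'_def
        by (rule DERIV_cong[OF DERIV_diff[OF der[OF s] Wd[OF s]]]) (simp add: algebra_simps)
      show "\<bar>u' s\<bar> \<le> (m + 1) * \<bar>u s\<bar> + (m * C + C1\<^sup>2) * (norm v)\<^sup>2" if s: "s \<in> {0..T}" for s
      proof -
        have 1: "\<bar>m * (R\<^sub>0 s v - W\<^sub>0 s v)\<bar> \<le> m * (C * (norm v)\<^sup>2)"
          using m RW0[OF s, of v] by (simp add: abs_mult mult_left_mono)
        have 2: "\<bar>m * u s\<bar> = m * \<bar>u s\<bar>" using m by (simp add: abs_mult)
        have 3: "\<bar>c s * u s\<bar> \<le> 1 * \<bar>u s\<bar>" unfolding abs_mult using c by (intro mult_right_mono) auto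
        have "\<bar>D s v - c s * R s v\<bar> \<le> (R s v)\<^sup>2" by (rule D(2)[OF s])
        also have "\<dots> \<le> (C1 * norm v)\<^sup>2" using R[OF s, of v] by (simp add: abs_le_square_iff[symmetric] abs_mult nonneg)
        finally have 4: "\<bar>D s v - c s * R s v\<bar> \<le> C1\<^sup>2 * (norm v)\<^sup>2" by (simp add: power_mult_distrib)
        have "\<bar>u' s\<bar> \<le> m * (C * (norm v)\<^sup>2) + m * \<bar>u s\<bar> + \<bar>u s\<bar> + C1\<^sup>2 * (norm v)\<^sup>2"
          using 1 2 3 4 unfolding u'_def by linarith
        then show ?thesis by (simp add: algebra_simps)
      qed
    qed (use m C in auto)
    then show ?thesis using Wi init by (simp add: u_def C2_def E_def algebra_simps)
  qed
  have "quadratic_approx T R W"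
    unfolding quadratic_approx_def
  proof (intro conjI ballI allI exI[of _ "max C1 C2"])
    show "continuous_on {0..T} (\<lambda>s. W s v)" for v
      using Wd by (meson DERIV_continuous continuous_on_eq_continuous_within)
    show "0 \<le> max C1 C2" using nonneg by simp
    show "\<bar>R s v\<bar> \<le> max C1 C2 * norm v" if "s \<in> {0..T}" for s v
      using R[OF that, of v] by (rule order_trans) (simp add: mult_right_mono)
    show "\<bar>R s v - W s v\<bar> \<le> max C1 C2 * (norm v)\<^sup>2" if "s \<in> {0..T}" for s v
      using RW[OF that, of v] by (rule order_trans) (simp add: mult_right_mono)
  qed (use Wlin in auto)
  then show ?thesis by (rule that)
qed

lemma quadratic_bound_has_derivative:
  fixes f :: "'v::euclidean_space \<Rightarrow> real"
  assumes L: "linear L" and bound: "\<And>v. \<bar>f (x + v) - f x - L v\<bar> \<le> C * (norm v)\<^sup>2"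
  shows "(f has_derivative L) (at x)"
  unfolding has_derivative_at
proof
  show "bounded_linear L" using L by (rule linear_conv_bounded_linear[THEN iffD1])
  show "(\<lambda>h. norm (f (x + h) - f x - L h) / norm h) \<midarrow>0\<rightarrow> 0"
  proof (rule Lim_null_comparison)
    show "((\<lambda>h. C * norm h) \<longlongrightarrow> 0) (at (0::'v))" by (auto intro!: tendsto_eq_intros)
    show "\<forall>\<^sub>F h in at 0. norm (norm (f (x + h) - f x - L h) / norm h) \<le> C * norm h"
    proof (rule always_eventually, rule)
      fix h show "norm (norm (f (x + h) - f x - L h) / norm h) \<le> C * norm h"
        using bound[of h] by (cases "h = 0") (auto simp: divide_simps power2_eq_square mult.assoc)
    qed
  qed
qed

section \<open>From finite differences to derivatives, and from lifts to tangent maps\<close>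

text \<open>\<open>D v\<close> is the limit of the difference quotients, which lie in the closed set
  \<open>S\<close>. The limit is one-sided because \<open>S\<close> admits only nonnegative
  factors.\<close>

lemma has_derivative_mem_closed_cone:
  fixes f :: "'a::real_normed_vector \<Rightarrow> 'b::real_normed_vector"
  assumes f: "(f has_derivative D) (at x)" and S: "closed S"
    and scale: "\<And>c u. 0 \<le> c \<Longrightarrow> u \<in> S \<Longrightarrow> c *\<^sub>R u \<in> S"
    and diff: "\<And>h. 0 < h \<Longrightarrow> f (x + h *\<^sub>R v) - f x \<in> S"
  shows "D v \<in> S"
proof -
  have "((\<lambda>h. x + h *\<^sub>R v) has_derivative (\<lambda>h. h *\<^sub>R v)) (at 0)"
    by (auto intro!: derivative_eq_intros)
  then have "((\<lambda>h. f (x + h *\<^sub>R v)) has_derivative (\<lambda>h. D (h *\<^sub>R v))) (at (0::real))"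
    using has_derivative_compose[of "\<lambda>h. x + h *\<^sub>R v" _ 0 UNIV f D] f by simp
  then have "((\<lambda>h. f (x + h *\<^sub>R v)) has_vector_derivative D v) (at 0)"
    unfolding has_vector_derivative_def
    using linear_cmul[OF has_derivative_linear[OF f]] by simp
  then have "((\<lambda>h. f (x + h *\<^sub>R v)) has_vector_derivative D v) (at_right 0)"
    by (rule has_vector_derivative_at_within)
  then have "((\<lambda>h. (1 / \<bar>h\<bar>) *\<^sub>R (f (x + h *\<^sub>R v) - (f x + h *\<^sub>R D v))) \<longlongrightarrow> 0) (at_right 0)"
    unfolding has_vector_derivative_def has_derivative_within by simp
  then have "((\<lambda>h. (1 / \<bar>h\<bar>) *\<^sub>R (f (x + h *\<^sub>R v) - (f x + h *\<^sub>R D v)) + D v) \<longlongrightarrow> D v)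
      (at_right 0)"
    using tendsto_add[OF _ tendsto_const] by force
  then have "((\<lambda>h. (f (x + h *\<^sub>R v) - f x) /\<^sub>R h) \<longlongrightarrow> D v) (at_right 0)"
    by (rule Lim_transform_eventually)
      (auto simp: eventually_at_right_field algebra_simps divide_inverse intro!: exI[of _ 1])
  moreover have "\<forall>\<^sub>F h in at_right 0. (f (x + h *\<^sub>R v) - f x) /\<^sub>R h \<in> S"
    unfolding eventually_at_right_field using diff scale by (intro exI[of _ 1]) auto
  ultimately show ?thesis using S by (intro Lim_in_closed_set[OF S]) auto
qed

text \<open>\<open>g - f\<close> is continuous at \<open>x\<close> and takes values in a discrete
  lattice near \<open>x\<close>, so it is constant there.\<close>

lemma lattice_rel_cong_derivative:
  fixes f g :: "'a::euclidean_space \<Rightarrow> real ^ 'n::finite"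
  assumes g: "(g has_derivative D) (at x)" and f: "isCont f x"
    and rel: "\<forall>\<^sub>F x' in nhds x. lattice_rel (g x') (f x')"
  shows "(f has_derivative D) (at x)"
proof -
  define e where "e x' = g x' - f x'" for x'
  obtain m\<^sub>0 :: int where m0: "e x = (2 * pi * of_int m\<^sub>0) *\<^sub>R (\<chi> a. 1)"
    using eventually_nhds_x_imp_x[OF rel] unfolding lattice_rel_def e_def by blast
  have "isCont e x" unfolding e_def using has_derivative_continuous[OF g] f by (intro continuous_intros)
  \<comment> \<open>Radius 1 is less than the spacing of the lattice, whose distinct points differ
    by at least \<open>2 * pi\<close> in each component.\<close>
  then have "\<forall>\<^sub>F x' in nhds x. dist (e x') (e x) < 1"
    unfolding continuous_at tendsto_iff isCont_def by (auto simp: eventually_nhds_conv_at)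
  then have "\<forall>\<^sub>F x' in nhds x. g x' - e x = f x'"
    using rel
  proof eventually_elim
    case (elim x')
    then obtain m :: int where m: "e x' = (2 * pi * of_int m) *\<^sub>R (\<chi> a. 1)"
      unfolding lattice_rel_def e_def by blast
    have "e x' - e x = (2 * pi * of_int (m - m\<^sub>0)) *\<^sub>R (\<chi> a. 1)"
      unfolding m m0 by (simp add: algebra_simps)
    \<comment> \<open>All components of the lattice vector are equal, so \<open>undefined\<close>
      serves as an arbitrary index.\<close>
    then have "\<bar>2 * pi * of_int (m - m\<^sub>0)\<bar> < (1::real)"
      using component_le_norm_cart[of "e x' - e x" undefined] elim by (simp add: dist_norm)
    moreover have "2 * pi \<le> \<bar>2 * pi * of_int (m - m\<^sub>0)\<bar>" if "m \<noteq> m\<^sub>0"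
      using that by (simp add: abs_mult flip: of_int_abs of_int_diff)
    ultimately have "m = m\<^sub>0" using pi_gt3 by fastforce
    then have "e x' = e x" using m m0 by simp
    then show ?case by (simp add: e_def algebra_simps)
  qed
  moreover have "((\<lambda>x'. g x' - e x) has_derivative D) (at x)"
    using g by (auto intro!: derivative_eq_intros)
  ultimately show ?thesis
    using has_derivative_transform_eventually[of "\<lambda>x'. g x' - e x" D x UNIV f]
    by (simp add: eventually_nhds_conv_at)
qed

section \<open>The random system in coordinates\<close>

lemma coord_coupling_matrix:
  fixes idx :: "'n::finite \<Rightarrow> nat"
  assumes idx: "bij_betw idx UNIV {1..CARD('n)}" and i: "i \<in> {1..CARD('n)}"
  shows "coord idx (coupling_matrix idx *v x) i =
    (if i = 1 then 0 else coord idx x (i - 1) - coord idx x i)"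
proof -
  obtain a where a: "idx a = i" using idx i by (metis bij_betw_iff_bijections)
  have inj: "idx b = idx c \<longleftrightarrow> b = c" for b c
    using idx by (auto simp: bij_betw_def inj_eq)
  have *: "coord idx (coupling_matrix idx *v x) i = (\<Sum>b\<in>UNIV. coupling_matrix idx $ a $ b * x $ b)"
    unfolding a[symmetric] coord_idx[OF idx] by (simp add: matrix_vector_mult_def)
  show ?thesis
  proof (cases "i = 1")
    case True
    then show ?thesis unfolding * using a by (simp add: coupling_matrix_def)
  next
    case False
    then have "i - 1 \<in> {1..CARD('n)}" using i by auto
    then obtain a' where a': "idx a' = i - 1" using idx by (metis bij_betw_iff_bijections)
    have ne: "a \<noteq> a'" using a a' False i by auto
    \<comment> \<open>The row has entry 1 at the predecessor and -1 on the diagonal, so the sum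
      collapses to two terms.\<close>
    have "coupling_matrix idx $ a $ b * x $ b =
        (if b = a' then x $ b else 0) - (if b = a then x $ b else 0)" for b
      unfolding coupling_matrix_def using a a' inj[of b a] inj[of b a'] ne False i by auto
    then have "(\<Sum>b\<in>UNIV. coupling_matrix idx $ a $ b * x $ b) = x $ a' - x $ a"
      by (simp add: sum_subtractf)
    then show ?thesis unfolding * using False a a' coord_idx[OF idx, of x] by metis
  qed
qed


lemma bounded_linear_coord: "bounded_linear (\<lambda>v. coord idx v i)"
  unfolding coord_def by (rule bounded_linear_vec_nth)

lemma coord_random_flow_has_derivative:
  fixes idx :: "'n::finite \<Rightarrow> nat"
  assumes idx: "bij_betw idx UNIV {1..CARD('n)}" and i: "i \<in> {1..CARD('n)}"
    and flow: "random_flow idx k \<alpha> \<epsilon> \<Omega> \<phi>" and \<omega>: "\<omega> \<in> \<Omega>"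
  shows "((\<lambda>s. coord idx (\<phi> s x \<omega>) i) has_real_derivative
     k * (if i = 1 then 0 else coord idx (\<phi> t x \<omega>) (i - 1) - coord idx (\<phi> t x \<omega>) i) +
     (\<alpha> i - sin (coord idx (\<phi> t x \<omega>) i + ou idx \<epsilon> i (shift t \<omega>)) +
      drift_correction idx k \<epsilon> i (shift t \<omega>))) (at t)"
proof -
  have "((\<lambda>s. \<phi> s x \<omega>) has_vector_derivative random_field idx k \<alpha> \<epsilon> (shift t \<omega>) (\<phi> t x \<omega>)) (at t)"
    using flow \<omega> unfolding random_flow_def by blast
  then have "((\<lambda>s. coord idx (\<phi> s x \<omega>) i) has_vector_derivative
      coord idx (random_field idx k \<alpha> \<epsilon> (shift t \<omega>) (\<phi> t x \<omega>)) i) (at t)"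
    by (rule bounded_linear.has_vector_derivative[OF bounded_linear_coord])
  moreover have "idx (inv idx i) = i" using idx i by (auto simp: bij_betw_def f_inv_into_f)
  ultimately show ?thesis
    unfolding has_real_derivative_iff_has_vector_derivative random_field_def
    using coord_coupling_matrix[OF idx i] by (simp add: coord_def of_coords_def add.assoc)
qed


section \<open>Invariance of the cone under finite differences\<close>

text \<open>The induction carries nonnegativity of \<open>r i\<close> together with the inequalities
  for the pair \<open>(i - 1, i)\<close>. These bound the derivative of \<open>r i\<close> in
  absolute value by \<open>(2 * i - 1) * r i\<close>, which is what the pair
  \<open>(i, i + 1)\<close> needs.\<close>

lemma chain_cone_invariant:
  fixes r D :: "nat \<Rightarrow> real \<Rightarrow> real"
  assumes der: "\<And>i s. i \<in> {1..N} \<Longrightarrow> s \<in> {0..T} \<Longrightarrow>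
      (r i has_real_derivative k * (if i = 1 then 0 else r (i - 1) s - r i s) - D i s)
        (at s within {0..T})"
    and D: "\<And>i s. i \<in> {1..N} \<Longrightarrow> s \<in> {0..T} \<Longrightarrow> \<bar>D i s\<bar> \<le> \<bar>r i s\<bar>"
    and k: "2 * real (N - 1) < k"
    and r0: "\<And>i. i \<in> {1..N} \<Longrightarrow> 0 \<le> r i 0"
    and init: "\<And>i. i \<in> {1..N - 1} \<Longrightarrow>
      gamma_coeff k i * r i 0 \<le> r (i + 1) 0 \<and> r (i + 1) 0 \<le> beta_coeff k i * r i 0"
    and t: "t \<in> {0..T}" and i: "i \<in> {1..N - 1}"
  shows "gamma_coeff k i * r i t \<le> r (i + 1) t \<and> r (i + 1) t \<le> beta_coeff k i * r i t"
proof -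
  have kpos: "0 < k" using k by linarith
  \<comment> \<open>With denominators cleared, \<open>\<gamma>\<close> is characterized by
    \<open>(k + 2 * i) * \<gamma> = k\<close>, and \<open>\<beta>\<close> below by
    \<open>(k - 2 * i) * \<beta> = k\<close>.\<close>
  have \<gamma>: "0 < gamma_coeff k i" "k * gamma_coeff k i + 2 * real i * gamma_coeff k i = k" for i
  proof -
    have "0 < 1 + 2 * real i * inverse k" using kpos by (simp add: add_pos_nonneg)
    moreover from this have "gamma_coeff k i * (1 + 2 * real i * inverse k) = 1"
      unfolding gamma_coeff_def by simp
    moreover have "k * x + 2 * real i * x = k * (x * (1 + 2 * real i * inverse k))" for x
      using kpos by (simp add: field_simps)
    ultimately show "0 < gamma_coeff k i"
      "k * gamma_coeff k i + 2 * real i * gamma_coeff k i = k"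
      by (simp_all add: gamma_coeff_def)
  qed
  have \<beta>: "0 < beta_coeff k i" "k * beta_coeff k i - 2 * real i * beta_coeff k i = k"
    if "i \<in> {1..N - 1}" for i
  proof -
    have "real i \<le> real (N - 1)" using that by simp
    then have "2 * real i < k" using k by linarith
    then have "0 < 1 - 2 * real i * inverse k" using kpos by (simp add: field_simps)
    moreover from this have "beta_coeff k i * (1 - 2 * real i * inverse k) = 1"
      unfolding beta_coeff_def by simp
    moreover have "k * x - 2 * real i * x = k * (x * (1 - 2 * real i * inverse k))" for x
      using kpos by (simp add: field_simps)
    ultimately show "0 < beta_coeff k i" "k * beta_coeff k i - 2 * real i * beta_coeff k i = k"
      by (simp_all add: beta_coeff_def)
  qed
  have main: "\<forall>s\<in>{0..T}. 0 \<le> r i s \<and>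
      (2 \<le> i \<longrightarrow> gamma_coeff k (i - 1) * r (i - 1) s \<le> r i s \<and> r i s \<le> beta_coeff k (i - 1) * r (i - 1) s)"
    if "1 \<le> i" "i \<le> N" for i
    using that
  proof (induction i rule: dec_induct)
    case base
    \<comment> \<open>Without a predecessor the derivative is \<open>- D 1 s\<close>, which is at
      least \<open>r 1 s\<close> wherever \<open>r 1 s\<close> is negative.\<close>
    have "0 \<le> r 1 s" if s: "s \<in> {0..T}" for s
    proof (rule nonneg_of_derivative_ge[OF der _ _ s, where K = 1])
      show "1 * r 1 s \<le> k * (if (1::nat) = 1 then 0 else r (1 - 1) s - r 1 s) - D 1 s"
        if "s \<in> {0..T}" "r 1 s < 0" for s
        using D[of 1 s] that base by auto
    qed (use r0 base in auto)
    then show ?case by simp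
  next
    case (step i)
    then have iN: "i \<in> {1..N}" "i + 1 \<in> {1..N}" "i \<in> {1..N - 1}" by auto
    define A where "A s = k * (if i = 1 then 0 else r (i - 1) s - r i s)" for s
    have ri: "0 \<le> r i s" if "s \<in> {0..T}" for s using step that by auto
    \<comment> \<open>Multiplying the cone inequalities of the preceding pair by
      \<open>k + 2 * (i - 1)\<close> and \<open>k - 2 * (i - 1)\<close>, both positive, turns their
      coefficients into \<open>k\<close>.\<close>
    have A: "A s \<le> 2 * (real i - 1) * r i s" "- 2 * (real i - 1) * r i s \<le> A s"
      if s: "s \<in> {0..T}" for s
    proof -
      have "A s \<le> 2 * (real i - 1) * r i s \<and> - 2 * (real i - 1) * r i s \<le> A s"
      proof (cases "i = 1")
        case False
        then have i1: "i - 1 \<in> {1..N - 1}" "2 \<le> i" "real (i - 1) = real i - 1" using iN by auto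
        define g b where "g = gamma_coeff k (i - 1)" and "b = beta_coeff k (i - 1)"
        have g: "g * r (i - 1) s \<le> r i s" and b: "r i s \<le> b * r (i - 1) s"
          using step s i1 by (auto simp: g_def b_def)
        have "(k + 2 * (real i - 1)) * (g * r (i - 1) s) \<le> (k + 2 * (real i - 1)) * r i s"
          using g kpos i1 by (intro mult_left_mono) auto
        moreover have "(k + 2 * (real i - 1)) * (g * r (i - 1) s) = k * r (i - 1) s"
          using arg_cong[OF \<gamma>(2)[of "i - 1"], of "\<lambda>z. z * r (i - 1) s"]
          unfolding i1(3) g_def[symmetric] by (simp add: algebra_simps)
        moreover have "real i - 1 \<le> real (N - 1)" using i1 by (metis atLeastAtMost_iff of_nat_mono)
        then have "(k - 2 * (real i - 1)) * r i s \<le> (k - 2 * (real i - 1)) * (b * r (i - 1) s)"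
          using b k by (intro mult_left_mono) auto
        moreover have "(k - 2 * (real i - 1)) * (b * r (i - 1) s) = k * r (i - 1) s"
          using arg_cong[OF \<beta>(2)[OF i1(1)], of "\<lambda>z. z * r (i - 1) s"]
          unfolding i1(3) b_def[symmetric] by (simp add: algebra_simps)
        ultimately show ?thesis using False by (simp add: A_def algebra_simps)
      qed (simp add: A_def)
      then show "A s \<le> 2 * (real i - 1) * r i s" "- 2 * (real i - 1) * r i s \<le> A s" by auto
    qed
    have der_i: "(r i has_real_derivative A s - D i s) (at s within {0..T})"
      and der_Suc: "(r (i + 1) has_real_derivative k * (r i s - r (i + 1) s) - D (i + 1) s)
        (at s within {0..T})" if "s \<in> {0..T}" for s
      using der[OF iN(1) that] der[OF iN(2) that] iN(1) by (auto simp: A_def)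
    have Di: "\<bar>D i s\<bar> \<le> r i s" if "s \<in> {0..T}" for s
      using D[OF iN(1) that] ri[OF that] by simp
    \<comment> \<open>Where \<open>r (i + 1)\<close> is negative, the coupling to the nonnegative
      \<open>r i\<close> pushes it upwards.\<close>
    have rSuc: "0 \<le> r (i + 1) s" if s: "s \<in> {0..T}" for s
    proof (rule nonneg_of_derivative_ge[OF der_Suc _ _ s, where K = 1])
      show "1 * r (i + 1) s \<le> k * (r i s - r (i + 1) s) - D (i + 1) s"
        if s: "s \<in> {0..T}" and neg: "r (i + 1) s < 0" for s
      proof -
        have "0 \<le> k * (r i s - r (i + 1) s)" using kpos ri[OF s] neg by simp
        then show ?thesis using D[OF iN(2) s] neg by linarith
      qed
    qed (use r0 iN in auto)
    have DSuc: "\<bar>D (i + 1) s\<bar> \<le> r (i + 1) s" if "s \<in> {0..T}" for s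
      using D[OF iN(2) that] rSuc[OF that] by simp
    define g b where "g = gamma_coeff k i" and "b = beta_coeff k i"
    have g: "0 < g" "k * g + 2 * real i * g = k" and b: "0 < b" "k * b - 2 * real i * b = k"
      using \<gamma> \<beta>[OF iN(3)] by (auto simp: g_def b_def)
    \<comment> \<open>A successor exists, so \<open>k > 2\<close>; the upper defect needs the factor
      \<open>k - 1\<close> to be nonnegative.\<close>
    have "1 \<le> real (N - 1)" using iN(3) by auto
    then have k1: "0 \<le> k - 1" using k by linarith
    \<comment> \<open>When \<open>r (i + 1) < g * r i\<close>, the derivative of the defect is at
      least \<open>(k - g * (k + 2 * i)) * r i\<close>, which is 0 by the choice of
      \<open>g\<close>.\<close>
    have lower: "0 \<le> r (i + 1) s - g * r i s" if s: "s \<in> {0..T}" for s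
    proof (rule nonneg_of_derivative_ge[where y = "\<lambda>s. r (i + 1) s - g * r i s", OF _ _ _ s, where K = 0])
      show "((\<lambda>s. r (i + 1) s - g * r i s) has_real_derivative
          k * (r i s - r (i + 1) s) - D (i + 1) s - g * (A s - D i s)) (at s within {0..T})"
        if "s \<in> {0..T}" for s
        using that by (intro DERIV_diff DERIV_cmult der_i der_Suc)
      show "0 * (r (i + 1) s - g * r i s) \<le>
          k * (r i s - r (i + 1) s) - D (i + 1) s - g * (A s - D i s)"
        if s: "s \<in> {0..T}" and neg: "r (i + 1) s - g * r i s < 0" for s
      proof -
        have "g * (A s - D i s) \<le> g * ((2 * real i - 1) * r i s)"
          using g(1) A(1)[OF s] Di[OF s] by (intro mult_left_mono) (auto simp: algebra_simps)
        moreover have "(k + 1) * r (i + 1) s \<le> (k + 1) * (g * r i s)"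
          using neg kpos by (intro mult_left_mono) auto
        moreover have "k * r i s = (k + 1) * (g * r i s) + g * ((2 * real i - 1) * r i s)"
          using arg_cong[OF g(2), of "\<lambda>z. z * r i s"] by (simp add: algebra_simps)
        moreover have "(k + 1) * r (i + 1) s = k * r (i + 1) s + r (i + 1) s"
          "k * (r i s - r (i + 1) s) = k * r i s - k * r (i + 1) s"
          by (simp_all add: algebra_simps)
        ultimately show ?thesis using DSuc[OF s] by linarith
      qed
    qed (use init[OF iN(3)] in \<open>auto simp: g_def\<close>)
    \<comment> \<open>Likewise the derivative is at least
      \<open>(b * (k - 2 * i) - k) * r i\<close>, again 0.\<close>
    have upper: "0 \<le> b * r i s - r (i + 1) s" if s: "s \<in> {0..T}" for s
    proof (rule nonneg_of_derivative_ge[where y = "\<lambda>s. b * r i s - r (i + 1) s", OF _ _ _ s, where K = 0])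
      show "((\<lambda>s. b * r i s - r (i + 1) s) has_real_derivative
          b * (A s - D i s) - (k * (r i s - r (i + 1) s) - D (i + 1) s)) (at s within {0..T})"
        if "s \<in> {0..T}" for s
        using that by (intro DERIV_diff DERIV_cmult der_i der_Suc)
      show "0 * (b * r i s - r (i + 1) s) \<le>
          b * (A s - D i s) - (k * (r i s - r (i + 1) s) - D (i + 1) s)"
        if s: "s \<in> {0..T}" and neg: "b * r i s - r (i + 1) s < 0" for s
      proof -
        have "b * (- (2 * real i - 1) * r i s) \<le> b * (A s - D i s)"
          using b(1) A(2)[OF s] Di[OF s] by (intro mult_left_mono) (auto simp: algebra_simps)
        moreover have "(k - 1) * (b * r i s) \<le> (k - 1) * r (i + 1) s"
          using neg k1 by (intro mult_left_mono) auto
        moreover have "k * r i s = (k - 1) * (b * r i s) + b * (- (2 * real i - 1) * r i s)"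
          using arg_cong[OF b(2), of "\<lambda>z. z * r i s"] by (simp add: algebra_simps)
        moreover have "(k - 1) * r (i + 1) s = k * r (i + 1) s - r (i + 1) s"
          "k * (r i s - r (i + 1) s) = k * r i s - k * r (i + 1) s"
          by (simp_all add: algebra_simps)
        ultimately show ?thesis using DSuc[OF s] by linarith
      qed
    qed (use init[OF iN(3)] in \<open>auto simp: b_def\<close>)
    show ?case using rSuc lower upper by (auto simp: g_def b_def)
  qed
  show ?thesis using main[of "i + 1"] t i by auto
qed


section \<open>Application to the random flow\<close>

text \<open>Two solutions for the same \<open>\<omega>\<close> share \<open>\<alpha>\<close> and the
  drift correction; these cancel, and of the nonlinearity only a difference of sines
  remains.\<close>

lemma random_flow_difference_has_derivative:
  fixes idx :: "'n::finite \<Rightarrow> nat" and x x' :: "real ^ 'n"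
  assumes idx: "bij_betw idx UNIV {1..CARD('n)}" and i: "i \<in> {1..CARD('n)}"
    and flow: "random_flow idx k \<alpha> \<epsilon> \<Omega> \<phi>" and \<omega>: "\<omega> \<in> \<Omega>"
  defines "r \<equiv> \<lambda>i s. coord idx (\<phi> s x' \<omega> - \<phi> s x \<omega>) i"
  shows "(r i has_real_derivative
      k * (if i = 1 then 0 else r (i - 1) s - r i s) -
      (sin (coord idx (\<phi> s x' \<omega>) i + ou idx \<epsilon> i (shift s \<omega>)) -
       sin (coord idx (\<phi> s x \<omega>) i + ou idx \<epsilon> i (shift s \<omega>)))) (at s within S)"
proof -
  note d = DERIV_subset[OF coord_random_flow_has_derivative[OF idx i flow \<omega>] subset_UNIV]
  have r: "r i s = coord idx (\<phi> s x' \<omega>) i - coord idx (\<phi> s x \<omega>) i" for i s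
    by (simp add: r_def coord_def)
  show ?thesis unfolding r by (rule DERIV_cong[OF DERIV_diff[OF d d]]) (auto simp: algebra_simps)
qed

lemma random_flow_differentiable:
  fixes idx :: "'n::finite \<Rightarrow> nat"
  assumes idx: "bij_betw idx UNIV {1..CARD('n)}" and k: "0 \<le> k"
    and \<Omega>: "full_path_set idx \<epsilon> P \<Omega>"
    and flow: "random_flow idx k \<alpha> \<epsilon> \<Omega> \<phi>" and \<omega>: "\<omega> \<in> \<Omega>" and T: "0 \<le> T"
  obtains L where "((\<lambda>x. \<phi> T x \<omega>) has_derivative L) (at x)"
proof -
  define R where "R i s v = coord idx (\<phi> s (x + v) \<omega> - \<phi> s x \<omega>) i" for i s v
  define Z where "Z i s = ou idx \<epsilon> i (shift s \<omega>)" for i s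
  define D where "D i s v = sin (coord idx (\<phi> s (x + v) \<omega>) i + Z i s)
    - sin (coord idx (\<phi> s x \<omega>) i + Z i s)" for i s v
  define c where "c i s = cos (coord idx (\<phi> s x \<omega>) i + Z i s)" for i s
  have der: "((\<lambda>s. R i s v) has_real_derivative
      k * (if i = 1 then 0 else R (i - 1) s v - R i s v) - D i s v) (at s within {0..T})"
    if "i \<in> {1..CARD('n)}" for i s v
    using random_flow_difference_has_derivative[OF idx that flow \<omega>, of "x + v" x]
    unfolding R_def D_def Z_def .
  have eq: "R i s v = (coord idx (\<phi> s (x + v) \<omega>) i + Z i s) - (coord idx (\<phi> s x \<omega>) i + Z i s)" for i s v
    by (simp add: R_def coord_def)
  have D1: "\<bar>D i s v\<bar> \<le> \<bar>R i s v\<bar>" for i s v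
    unfolding D_def eq by (rule abs_sin_diff_le)
  have D2: "\<bar>D i s v - c i s * R i s v\<bar> \<le> (R i s v)\<^sup>2" for i s v
    unfolding D_def eq c_def by (rule abs_sin_diff_linear_le)
  \<comment> \<open>Continuity in time of the stationary process along the shift is part of the
    choice of \<open>\<Omega>\<close>.\<close>
  have c: "continuous_on {0..T} (c i)" if i: "i \<in> {1..CARD('n)}" for i
  proof -
    have "continuous_on {0..T} (Z i)"
      using \<Omega> \<omega> i unfolding full_path_set_def Z_def by (blast intro: continuous_on_subset)
    moreover have "continuous_on {0..T} (\<lambda>s. coord idx (\<phi> s x \<omega>) i)"
      using coord_random_flow_has_derivative[OF idx i flow \<omega>, of x]
      by (intro continuous_at_imp_continuous_on ballI DERIV_isCont) auto
    ultimately show ?thesis unfolding c_def by (intro continuous_intros)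
  qed
  have R0: "R i 0 v = coord idx v i" for i v
    using flow \<omega> by (simp add: R_def random_flow_def)
  have lin: "linear (\<lambda>v. coord idx v i)" for i
    by (rule bounded_linear.linear[OF bounded_linear_coord])
  have norm: "\<bar>coord idx v i\<bar> \<le> norm v" for i v
    unfolding coord_def by (rule component_le_norm_cart)
  have "\<exists>W. quadratic_approx T (R i) W" if "1 \<le> i" "i \<le> CARD('n)" for i
    using that
  proof (induction i rule: dec_induct)
    case base
    \<comment> \<open>The first coordinate receives a fictitious zero predecessor with coupling
      \<open>m = 0\<close>.\<close>
    have "quadratic_approx T (\<lambda>s (v::real^'n). 0) (\<lambda>s v. 0)"
      unfolding quadratic_approx_def by (auto intro!: linearI)
    then show ?case
      by (rule quadratic_approx_step[where R = "R 1" and D = "D 1" and c = "c 1" and m = 0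
            and l = "\<lambda>v. coord idx v 1"])
        (use der[of 1] D1 D2 c[of 1] R0 lin norm base T in \<open>auto simp: c_def\<close>)
  next
    case (step i)
    then obtain W where W: "quadratic_approx T (R i) W" by auto
    show ?case
      by (rule quadratic_approx_step[OF W, where R = "R (Suc i)" and D = "D (Suc i)"
            and c = "c (Suc i)" and m = k and l = "\<lambda>v. coord idx v (Suc i)"])
        (use der[of "Suc i"] D1 D2 c[of "Suc i"] R0 lin norm step k T in \<open>auto simp: c_def\<close>)
  qed
  then obtain W where W: "\<And>i. i \<in> {1..CARD('n)} \<Longrightarrow> quadratic_approx T (R i) (W i)"
    by (metis atLeastAtMost_iff)
  have "((\<lambda>y. \<phi> T y \<omega> $ a) has_derivative W (idx a) T) (at x)" for a
  proof -
    have "idx a \<in> {1..CARD('n)}" using idx by (auto simp: bij_betw_def)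
    then have lin: "linear (W (idx a) T)"
      and "\<exists>C. \<forall>v. \<bar>R (idx a) T v - W (idx a) T v\<bar> \<le> C * (norm v)\<^sup>2"
      using W[of "idx a"] T unfolding quadratic_approx_def by (simp, force)
    then obtain C where "\<And>v. \<bar>R (idx a) T v - W (idx a) T v\<bar> \<le> C * (norm v)\<^sup>2"
      by blast
    then show ?thesis using lin
      by (intro quadratic_bound_has_derivative[of _ _ _ C]) (auto simp: R_def coord_idx[OF idx])
  qed
  then have "((\<lambda>y. \<phi> T y \<omega>) has_derivative (\<lambda>v. \<chi> a. W (idx a) T v)) (at x)"
    by (subst has_derivative_componentwise_within)
      (auto simp: Basis_vec_def inner_axis)
  then show ?thesis by (rule that)
qed

text \<open>The global Lipschitz bound of the sine allows displacements \<open>v\<close> of any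
  size. The cone field is constant, so the paths and base points at which it is taken may
  differ.\<close>

lemma random_flow_cone_invariant:
  fixes idx :: "'n::finite \<Rightarrow> nat"
  assumes idx: "bij_betw idx UNIV {1..CARD('n)}" and k: "2 * real (CARD('n) - 1) < k"
    and flow: "random_flow idx k \<alpha> \<epsilon> \<Omega> \<phi>" and \<omega>: "\<omega> \<in> \<Omega>" and T: "0 \<le> T"
    and v: "v \<in> chain_cone_field idx k \<omega>' y" "v \<in> standard_cone_field \<omega>' y"
  shows "\<phi> T (x + v) \<omega> - \<phi> T x \<omega> \<in> chain_cone_field idx k \<omega>'' y'"
proof -
  define r where "r i s = coord idx (\<phi> s (x + v) \<omega> - \<phi> s x \<omega>) i" for i s
  define D where "D i s = sin (coord idx (\<phi> s (x + v) \<omega>) i + ou idx \<epsilon> i (shift s \<omega>))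
    - sin (coord idx (\<phi> s x \<omega>) i + ou idx \<epsilon> i (shift s \<omega>))" for i s
  have r0: "r i 0 = coord idx v i" for i
    using flow \<omega> by (simp add: r_def random_flow_def)
  have "gamma_coeff k i * r i T \<le> r (i + 1) T \<and> r (i + 1) T \<le> beta_coeff k i * r i T"
    if "i \<in> {1..CARD('n) - 1}" for i
  proof (rule chain_cone_invariant[of "CARD('n)" T r k D, OF _ _ k _ _ _ that])
    show "(r i has_real_derivative k * (if i = 1 then 0 else r (i - 1) s - r i s) - D i s)
        (at s within {0..T})" if "i \<in> {1..CARD('n)}" for i s
      using random_flow_difference_has_derivative[OF idx that flow \<omega>, of "x + v" x]
      unfolding r_def D_def .
    show "\<bar>D i s\<bar> \<le> \<bar>r i s\<bar>" for i s
      using abs_sin_diff_le[of "coord idx (\<phi> s (x + v) \<omega>) i + ou idx \<epsilon> i (shift s \<omega>)"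
          "coord idx (\<phi> s x \<omega>) i + ou idx \<epsilon> i (shift s \<omega>)"]
      by (simp add: D_def r_def coord_def)
    show "0 \<le> r i 0" for i using v(2) by (simp add: r0 standard_cone_field_def coord_def)
    show "gamma_coeff k i * r i 0 \<le> r (i + 1) 0 \<and> r (i + 1) 0 \<le> beta_coeff k i * r i 0"
      if "i \<in> {1..CARD('n) - 1}" for i
      using v(1) that unfolding chain_cone_field_def r0 by force
  qed (use T in auto)
  then show ?thesis by (auto simp: chain_cone_field_def r_def)
qed

section \<open>The tangent map of the quotient system and the two ranges of \<open>k\<close>\<close>

text \<open>The lift \<open>f\<close> shows that the choice in \<open>tangent_map\<close> has a
  witness. The chosen map may come from another local lift \<open>g\<close> at another
  representative, but \<open>f\<close> and \<open>g\<close> lift the same map and so share the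
  derivative there.\<close>

lemma tangent_map_has_derivative:
  assumes lift: "\<And>x. F (proj x) = proj (f x)" and f: "\<And>x. f differentiable (at x)"
  obtains x where "proj x = y" "(f has_derivative tangent_map F y) (at x)"
proof -
  obtain x\<^sub>0 where x0: "proj x\<^sub>0 = y" using surj_proj by (metis surjD)
  obtain L where "(f has_derivative L) (at x\<^sub>0)" using f by (auto simp: differentiable_def)
  then have "has_tangent_map F L y"
    unfolding has_tangent_map_def using x0 lift by (intro exI[of _ x\<^sub>0] exI[of _ f]) auto
  then have "has_tangent_map F (tangent_map F y) y"
    unfolding tangent_map_def by (rule someI[of "\<lambda>D. has_tangent_map F D y"])
  then obtain x g where x: "proj x = y"
    and g: "\<forall>\<^sub>F x' in nhds x. proj (g x') = F (proj x')" "(g has_derivative tangent_map F y) (at x)"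
    unfolding has_tangent_map_def by blast
  have "(f has_derivative tangent_map F y) (at x)"
    using g(1) by (intro lattice_rel_cong_derivative[OF g(2) differentiable_imp_continuous_within[OF f]])
      (simp add: lift proj_eq_iff)
  with x show ?thesis by (rule that)
qed

text \<open>
  For \<open>k < 2 (N - 1)\<close> the coefficient \<open>\<beta>\<^sub>N\<^sub>-\<^sub>1\<close> is negative, and within the orthant the cone collapses.
\<close>

lemma chain_cone_degenerate:
  fixes idx :: "'n::finite \<Rightarrow> nat"
  assumes N: "2 \<le> CARD('n)" and idx: "bij_betw idx UNIV {1..CARD('n)}"
    and k: "0 < k" "k < 2 * real (CARD('n) - 1)"
    and v: "v \<in> chain_cone_field idx k \<omega> y" "v \<in> standard_cone_field \<omega> y"
  shows "v = 0"
proof -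
  define n where "n = CARD('n) - 1"
  have n: "1 \<le> n" "CARD('n) = n + 1" using N by (auto simp: n_def)
  have nonneg: "0 \<le> coord idx v i" for i using v(2) by (simp add: standard_cone_field_def coord_def)
  have cone: "gamma_coeff k i * coord idx v i \<le> coord idx v (i + 1)"
    "coord idx v (i + 1) \<le> beta_coeff k i * coord idx v i" if "1 \<le> i" "i \<le> n" for i
    using v(1) that by (auto simp: chain_cone_field_def n_def)
  have \<gamma>: "0 < gamma_coeff k i" for i
    unfolding gamma_coeff_def using k by (simp add: add_pos_nonneg)
  have \<beta>: "beta_coeff k n < 0"
    unfolding beta_coeff_def inverse_negative_iff_negative
    using k unfolding n_def[symmetric] by (simp add: field_simps)
  \<comment> \<open>The last upper inequality has a negative coefficient in front of a nonnegative
    coordinate.\<close>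
  have "coord idx v (n + 1) \<le> 0"
    using cone(2)[OF n(1)] mult_nonpos_nonneg[of "beta_coeff k n" "coord idx v n"] \<beta> nonneg[of n] by simp
  then have last: "coord idx v (n + 1) = 0" using nonneg[of "n + 1"] by simp
  \<comment> \<open>Descending induction: positive \<gamma> passes the vanishing from each
    coordinate to its predecessor.\<close>
  have "coord idx v i = 0" if "i \<le> n + 1" "1 \<le> i" for i
    using that
  proof (induction rule: inc_induct)
    case base
    show ?case by (rule last)
  next
    case (step i)
    then have "gamma_coeff k i * coord idx v i \<le> 0" using cone(1)[of i] by simp
    then show ?case using \<gamma>[of i] nonneg[of i] by (simp add: mult_le_0_iff)
  qed
  moreover have "idx a \<in> {1..n + 1}" for a
    using idx unfolding bij_betw_def n(2) by blast
  ultimately have "v $ a = 0" for a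
    using coord_idx[OF idx, of v a] by (metis atLeastAtMost_iff)
  then show ?thesis by (simp add: vec_eq_iff)
qed

theorem proposition3p1:
  fixes idx :: "'n::finite \<Rightarrow> nat"
    and k :: real
    and \<alpha> \<epsilon> :: "nat \<Rightarrow> real"
    and P :: "'n path measure"
    and \<Omega> :: "'n path set"
    and \<phi> :: "real \<Rightarrow> real ^ 'n \<Rightarrow> 'n path \<Rightarrow> real ^ 'n"
    and \<Phi> :: "real \<Rightarrow> 'n cylinder \<Rightarrow> 'n path \<Rightarrow> 'n cylinder"
  assumes "CARD('n) \<ge> 2"
    and "bij_betw idx UNIV {1..CARD('n)}"
    and "k > 0"
    and "\<And>i. i \<in> {1..CARD('n)} \<Longrightarrow> \<epsilon> i > 0"
    and "wiener_measure P"
    and "full_path_set idx \<epsilon> P \<Omega>"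
    and "random_flow idx k \<alpha> \<epsilon> \<Omega> \<phi>"
    and "\<And>t x \<omega>. \<omega> \<in> \<Omega> \<Longrightarrow> \<Phi> t (proj x) \<omega> = proj (\<phi> t x \<omega>)"
    and "\<And>i. i \<in> {1..CARD('n) - 1} \<Longrightarrow> 1 - 2 * real i * inverse k \<noteq> 0"
    and "cone_field_refines \<Omega> (chain_cone_field idx k) standard_cone_field"
  shows "differentially_positive \<Omega> \<Phi> (chain_cone_field idx k)"
  unfolding differentially_positive_def
proof (intro allI impI ballI subsetI)
  fix t y \<omega> w
  assume t: "0 \<le> t" and \<omega>: "\<omega> \<in> \<Omega>"
    and "w \<in> tangent_map (\<lambda>y'. \<Phi> t y' \<omega>) y ` chain_cone_field idx k \<omega> y"
  then obtain v where w: "w = tangent_map (\<lambda>y'. \<Phi> t y' \<omega>) y v" and v: "v \<in> chain_cone_field idx k \<omega> y"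
    by blast
  have std: "v \<in> standard_cone_field \<omega> y"
    using assms(10) \<omega> v unfolding cone_field_refines_def by blast
  have "(\<lambda>x. \<phi> t x \<omega>) differentiable (at x)" for x
    using random_flow_differentiable[OF assms(2) _ assms(6,7) \<omega> t, of x] assms(3)
    by (metis differentiable_def less_imp_le)
  then obtain x where der: "((\<lambda>x. \<phi> t x \<omega>) has_derivative tangent_map (\<lambda>y'. \<Phi> t y' \<omega>) y) (at x)"
    using tangent_map_has_derivative[of "\<lambda>y'. \<Phi> t y' \<omega>" "\<lambda>x. \<phi> t x \<omega>" y] assms(8)[OF \<omega>] by blast
  have "CARD('n) - 1 \<in> {1..CARD('n) - 1}" using assms(1) by auto
  \<comment> \<open>Equality would make the denominator of the last \<beta> vanish.\<close>
  then have "k \<noteq> 2 * real (CARD('n) - 1)" using assms(9) assms(3) by fastforce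
  then consider "2 * real (CARD('n) - 1) < k" | "k < 2 * real (CARD('n) - 1)" by linarith
  then show "w \<in> chain_cone_field idx k (shift t \<omega>) (\<Phi> t y \<omega>)"
  proof cases
    case 1
    have cone: "closed_convex_cone (chain_cone_field idx k \<omega> y)" for y :: "'n cylinder"
      using closed_convex_cone_chain[OF assms(10) \<omega>] .
    have const: "chain_cone_field idx k \<omega>' y' = chain_cone_field idx k \<omega> y" for \<omega>' y'
      by (simp add: chain_cone_field_def)
    have "w \<in> chain_cone_field idx k \<omega> y" unfolding w
    proof (rule has_derivative_mem_closed_cone[OF der])
      show "\<phi> t (x + h *\<^sub>R v) \<omega> - \<phi> t x \<omega> \<in> chain_cone_field idx k \<omega> y" if "0 < h" for h
      proof (rule random_flow_cone_invariant[OF assms(2) 1 assms(7) \<omega> t])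
        show "h *\<^sub>R v \<in> chain_cone_field idx k \<omega> y"
          using cone[of y] v that by (simp add: closed_convex_cone_def)
        show "h *\<^sub>R v \<in> standard_cone_field \<omega> y" using std that by (simp add: standard_cone_field_def)
      qed
    qed (use cone[of y] in \<open>auto simp: closed_convex_cone_def\<close>)
    then show ?thesis by (simp add: const[of "shift t \<omega>"])
  next
    case 2
    \<comment> \<open>Containment in the orthant leaves only the zero vector in the cone, and a
      linear map preserves it.\<close>
    then have "w = 0"
      using chain_cone_degenerate[OF assms(1-3) 2 v std] linear_0[OF has_derivative_linear[OF der]] w
      by simp
    then show ?thesis by (simp add: chain_cone_field_def coord_def)
  qed
qed

end
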